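(* For a morphism $\varphi:S\to T$ in $\mathsf{CRig}_g$, the formula $\mathrm{Id}_g(\varphi)(I)=\bigvee^{g}_{a\in I}\langle\varphi(a)\rangle_g$ (join in $\mathrm{Id}_g(T)$) defines a coherent frame homomorphism $\mathrm{Id}_g(S)\to\mathrm{Id}_g(T)$. Hence $\mathrm{Id}_g:\mathsf{CRig}_g\to\mathsf{CohFrm}$ is a functor.
   Context: A semiring here is commutative with $0$ and $1$: $(S,+,0)$ and $(S,\cdot,1)$ are commutative monoids, multiplication distributes over addition, and $0s=0$; homomorphisms preserve $0$ and $1$. An ideal is a non-empty subset closed under addition and under multiplication by arbitrary elements; maximal ideals are proper; $\mathrm{Id}(S)$ is the set of all ideals. With $\mathcal M(a)$ the set of maximal ideals containing $a$, an ideal $I$ is a $z$-ideal if $a\in I$ and $\mathcal M(a)=\mathcal M(b)$ imply $b\in I$. A congruence is an equivalence relation compatible with $+$ and $\cdot$; maximal congruences are maximal among proper ones ($\neq S\times S$). The zero-class of $\theta$ is $0_\theta=\{a\mid(a,0)\in\theta\}$. For an ideal $I$, $\wp_I$ is the intersection of all maximal congruences $\theta$ with $I\subseteq0_\theta$ ($S\times S$ if there are none), $g(I)=I^g=0_{\wp_I}$, and $I$ is $g$-closed if $I=I^g$. $\mathrm{Id}_g(S)$ is the set of $g$-closed ideals ordered by inclusion; $\langle a\rangle_g=(\langle a\rangle)^g$, and $g$-joins are $\bigvee^g_\lambda I_\lambda=(\sum_\lambda I_\lambda)^g$, with binary join $\vee_g$. $S$ satisfies the finite-type $g$-closure hypothesis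 if: (G1) $g:\mathrm{Id}(S)\to\mathrm{Id}(S)$ is of finite type (each element of $I^g$ lies in $F^g$ for some finitely generated ideal $F\subseteq I$); (G2) the fixed points of $g$ form a frame with meet given by intersection and join given by $g$ applied to sums; (G3) the compact elements of this frame are exactly the finite $g$-joins $\langle a_1\rangle_g\vee_g\cdots\vee_g\langle a_n\rangle_g$; (G4) $\langle a\rangle_g\cap\langle b\rangle_g=\langle ab\rangle_g$ for all $a,b\in S$, and hence finite $g$-joins of principal $g$-closures are closed under finite meets. $\mathsf{CRig}_g$ is the category whose objects are the commutative semirings satisfying the finite-type $g$-closure hypothesis and whose morphisms are semiring homomorphisms $\varphi:S\to T$ such that inverse images of $z$-ideals of $T$ are $z$-ideals of $S$ and inverse images of $g$-closed ideals of $T$ are $g$-closed in $S$. $\mathsf{CohFrm}$ is the category of coherent frames (top compact, every element a join of compact elements, compact elements closed under finite meets) and frame homomorphisms (preserving arbitrary joins and finite meets) that preserve compact elements, called coherent frame homomorphisms. *)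

theory Defs
  imports "HOL-Algebra.Ring"
begin

section \<open>Commutative semirings, ideals and congruences\<close>

text \<open>The trivial semiring is allowed.\<close>
locale comm_semiring = semiring S + comm_monoid S for S (structure)

definition sr_hom :: "('a, 'm) ring_scheme \<Rightarrow> ('b, 'n) ring_scheme \<Rightarrow> ('a \<Rightarrow> 'b) set" where
  "sr_hom S T = {h \<in> ring_hom S T. h \<zero>\<^bsub>S\<^esub> = \<zero>\<^bsub>T\<^esub>}"

definition sr_ideal :: "('a, 'm) ring_scheme \<Rightarrow> 'a set \<Rightarrow> bool" where
  "sr_ideal S I \<longleftrightarrow> I \<noteq> {} \<and> I \<subseteq> carrier S \<and>
     (\<forall>a\<in>I. \<forall>b\<in>I. a \<oplus>\<^bsub>S\<^esub> b \<in> I) \<and> (\<forall>s\<in>carrier S. \<forall>a\<in>I. s \<otimes>\<^bsub>S\<^esub> a \<in> I)"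

definition gen_ideal :: "('a, 'm) ring_scheme \<Rightarrow> 'a set \<Rightarrow> 'a set" where
  "gen_ideal S A = \<Inter>{I. sr_ideal S I \<and> A \<subseteq> I}"

definition fg_ideal :: "('a, 'm) ring_scheme \<Rightarrow> 'a set \<Rightarrow> bool" where
  "fg_ideal S I \<longleftrightarrow> (\<exists>A. finite A \<and> A \<subseteq> carrier S \<and> I = gen_ideal S A)"

text \<open>The sum of a set of ideals: all finite sums of elements of its members. A repeated
  member of a family contributes nothing new, so families are replaced by their ranges.
  The empty sum is the zero ideal.\<close>
definition ideal_sum :: "('a, 'm) ring_scheme \<Rightarrow> 'a set set \<Rightarrow> 'a set" where
  "ideal_sum S \<I> = {finsum S x F | F x. finite F \<and> F \<subseteq> \<I> \<and> (\<forall>I\<in>F. x I \<in> I)}"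

definition max_ideal :: "('a, 'm) ring_scheme \<Rightarrow> 'a set \<Rightarrow> bool" where
  "max_ideal S M \<longleftrightarrow> sr_ideal S M \<and> M \<noteq> carrier S \<and>
     (\<forall>J. sr_ideal S J \<and> M \<subseteq> J \<and> J \<noteq> carrier S \<longrightarrow> J = M)"

definition max_ideals_at :: "('a, 'm) ring_scheme \<Rightarrow> 'a \<Rightarrow> 'a set set" where
  "max_ideals_at S a = {M. max_ideal S M \<and> a \<in> M}"

definition z_ideal :: "('a, 'm) ring_scheme \<Rightarrow> 'a set \<Rightarrow> bool" where
  "z_ideal S I \<longleftrightarrow> sr_ideal S I \<and>
     (\<forall>a\<in>I. \<forall>b\<in>carrier S. max_ideals_at S a = max_ideals_at S b \<longrightarrow> b \<in> I)"

definition sr_congruence :: "('a, 'm) ring_scheme \<Rightarrow> ('a \<times> 'a) set \<Rightarrow> bool" where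
  "sr_congruence S \<theta> \<longleftrightarrow> equiv (carrier S) \<theta> \<and>
     (\<forall>(a, b)\<in>\<theta>. \<forall>(c, d)\<in>\<theta>. (a \<oplus>\<^bsub>S\<^esub> c, b \<oplus>\<^bsub>S\<^esub> d) \<in> \<theta> \<and> (a \<otimes>\<^bsub>S\<^esub> c, b \<otimes>\<^bsub>S\<^esub> d) \<in> \<theta>)"

definition max_congruence :: "('a, 'm) ring_scheme \<Rightarrow> ('a \<times> 'a) set \<Rightarrow> bool" where
  "max_congruence S \<theta> \<longleftrightarrow> sr_congruence S \<theta> \<and> \<theta> \<noteq> carrier S \<times> carrier S \<and>
     (\<forall>\<rho>. sr_congruence S \<rho> \<and> \<theta> \<subseteq> \<rho> \<and> \<rho> \<noteq> carrier S \<times> carrier S \<longrightarrow> \<rho> = \<theta>)"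

definition zero_class :: "('a, 'm) ring_scheme \<Rightarrow> ('a \<times> 'a) set \<Rightarrow> 'a set" where
  "zero_class S \<theta> = {a. (a, \<zero>\<^bsub>S\<^esub>) \<in> \<theta>}"

section \<open>The operator g and g-closed ideals\<close>

text \<open>Intersecting inside \<open>S \<times> S\<close> gives \<open>S \<times> S\<close> when there is no such maximal congruence.\<close>
definition wp :: "('a, 'm) ring_scheme \<Rightarrow> 'a set \<Rightarrow> ('a \<times> 'a) set" where
  "wp S I = (carrier S \<times> carrier S) \<inter> \<Inter>{\<theta>. max_congruence S \<theta> \<and> I \<subseteq> zero_class S \<theta>}"

definition g_cl :: "('a, 'm) ring_scheme \<Rightarrow> 'a set \<Rightarrow> 'a set" where
  "g_cl S I = zero_class S (wp S I)"

definition g_closed :: "('a, 'm) ring_scheme \<Rightarrow> 'a set \<Rightarrow> bool" where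
  "g_closed S I \<longleftrightarrow> sr_ideal S I \<and> g_cl S I = I"

definition Id_g :: "('a, 'm) ring_scheme \<Rightarrow> 'a set gorder" where
  "Id_g S = \<lparr>carrier = {I. g_closed S I}, eq = (=), le = (\<subseteq>)\<rparr>"

definition g_prin :: "('a, 'm) ring_scheme \<Rightarrow> 'a \<Rightarrow> 'a set" where
  "g_prin S a = g_cl S (gen_ideal S {a})"

definition g_join :: "('a, 'm) ring_scheme \<Rightarrow> 'a set set \<Rightarrow> 'a set" where
  "g_join S \<I> = g_cl S (ideal_sum S \<I>)"

section \<open>Coherent frames\<close>

locale frame = complete_lattice L for L (structure) +
  assumes meet_sup_distrib:
    "\<lbrakk>x \<in> carrier L; A \<subseteq> carrier L\<rbrakk> \<Longrightarrow> x \<sqinter> (\<Squnion> A) = \<Squnion> ((\<lambda>a. x \<sqinter> a) ` A)"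

definition compact_elems :: "('l, 'm) gorder_scheme \<Rightarrow> 'l set" where
  "compact_elems L = {c \<in> carrier L. \<forall>A \<subseteq> carrier L. c \<sqsubseteq>\<^bsub>L\<^esub> \<Squnion>\<^bsub>L\<^esub> A \<longrightarrow>
     (\<exists>F. finite F \<and> F \<subseteq> A \<and> c \<sqsubseteq>\<^bsub>L\<^esub> \<Squnion>\<^bsub>L\<^esub> F)}"

locale coherent_frame = frame L for L (structure) +
  assumes top_compact: "\<top> \<in> compact_elems L"
    and join_of_compacts: "x \<in> carrier L \<Longrightarrow> \<exists>A \<subseteq> compact_elems L. x = \<Squnion> A"
    and meet_compact:
      "\<lbrakk>x \<in> compact_elems L; y \<in> compact_elems L\<rbrakk> \<Longrightarrow> x \<sqinter> y \<in> compact_elems L"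

text \<open>Finite meets include the empty one, so the top element is preserved.\<close>
definition coherent_frame_hom ::
    "('l, 'm) gorder_scheme \<Rightarrow> ('k, 'n) gorder_scheme \<Rightarrow> ('l \<Rightarrow> 'k) set" where
  "coherent_frame_hom L M = {f \<in> carrier L \<rightarrow> carrier M.
     (\<forall>A \<subseteq> carrier L. f (\<Squnion>\<^bsub>L\<^esub> A) = \<Squnion>\<^bsub>M\<^esub> (f ` A)) \<and>
     (\<forall>A \<subseteq> carrier L. finite A \<longrightarrow> f (\<Sqinter>\<^bsub>L\<^esub> A) = \<Sqinter>\<^bsub>M\<^esub> (f ` A)) \<and>
     f ` compact_elems L \<subseteq> compact_elems M}"

section \<open>The finite-type g-closure hypothesis\<close>

text \<open>In \<open>G3\<close> the n-ary g-join is taken of the set of its terms; the empty g-join,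
  \<open>g_cl\<close> of the zero ideal, equals \<open>\<langle>0\<rangle>\<^sub>g\<close>, so admitting it adds nothing.\<close>
locale ft_g_semiring = comm_semiring S for S (structure) +
  assumes G1: "\<lbrakk>sr_ideal S I; x \<in> g_cl S I\<rbrakk> \<Longrightarrow> \<exists>F. fg_ideal S F \<and> F \<subseteq> I \<and> x \<in> g_cl S F"
    and G2_frame: "frame (Id_g S)"
    and G2_meet: "\<lbrakk>g_closed S I; g_closed S J\<rbrakk> \<Longrightarrow> I \<sqinter>\<^bsub>Id_g S\<^esub> J = I \<inter> J"
    and G2_join: "\<I> \<subseteq> carrier (Id_g S) \<Longrightarrow> \<Squnion>\<^bsub>Id_g S\<^esub> \<I> = g_join S \<I>"
    and G3: "compact_elems (Id_g S) = {g_join S (g_prin S ` A) | A. finite A \<and> A \<subseteq> carrier S}"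
    and G4: "\<lbrakk>a \<in> carrier S; b \<in> carrier S\<rbrakk> \<Longrightarrow> g_prin S a \<inter> g_prin S b = g_prin S (a \<otimes> b)"

definition g_hom :: "('a, 'm) ring_scheme \<Rightarrow> ('b, 'n) ring_scheme \<Rightarrow> ('a \<Rightarrow> 'b) set" where
  "g_hom S T = {\<phi> \<in> sr_hom S T.
     (\<forall>J. z_ideal T J \<longrightarrow> z_ideal S (\<phi> -` J \<inter> carrier S)) \<and>
     (\<forall>J. g_closed T J \<longrightarrow> g_closed S (\<phi> -` J \<inter> carrier S))}"

definition Id_g_map ::
    "('a, 'm) ring_scheme \<Rightarrow> ('b, 'n) ring_scheme \<Rightarrow> ('a \<Rightarrow> 'b) \<Rightarrow> 'a set \<Rightarrow> 'b set" where
  "Id_g_map S T \<phi> = (\<lambda>I \<in> carrier (Id_g S). g_join T ((\<lambda>a. g_prin T (\<phi> a)) ` I))"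

section \<open>Categories and functors\<close>

record ('o, 'm) category =
  cobj :: "'o set"
  chom :: "'o \<Rightarrow> 'o \<Rightarrow> 'm set"
  cid :: "'o \<Rightarrow> 'm"
  ccomp :: "'o \<Rightarrow> 'o \<Rightarrow> 'o \<Rightarrow> 'm \<Rightarrow> 'm \<Rightarrow> 'm"
    \<comment> \<open>\<open>ccomp C X Y Z g f\<close> is the composite of \<open>f : X \<rightarrow> Y\<close> and \<open>g : Y \<rightarrow> Z\<close>\<close>

locale is_category =
  fixes C :: "('o, 'm) category"
  assumes id_hom: "X \<in> cobj C \<Longrightarrow> cid C X \<in> chom C X X"
    and comp_hom: "\<lbrakk>X \<in> cobj C; Y \<in> cobj C; Z \<in> cobj C; f \<in> chom C X Y; g \<in> chom C Y Z\<rbrakk>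
      \<Longrightarrow> ccomp C X Y Z g f \<in> chom C X Z"
    and comp_id_right: "\<lbrakk>X \<in> cobj C; Y \<in> cobj C; f \<in> chom C X Y\<rbrakk>
      \<Longrightarrow> ccomp C X X Y f (cid C X) = f"
    and comp_id_left: "\<lbrakk>X \<in> cobj C; Y \<in> cobj C; f \<in> chom C X Y\<rbrakk>
      \<Longrightarrow> ccomp C X Y Y (cid C Y) f = f"
    and comp_assoc: "\<lbrakk>W \<in> cobj C; X \<in> cobj C; Y \<in> cobj C; Z \<in> cobj C;
        f \<in> chom C W X; g \<in> chom C X Y; h \<in> chom C Y Z\<rbrakk>
      \<Longrightarrow> ccomp C W X Z (ccomp C X Y Z h g) f = ccomp C W Y Z h (ccomp C W X Y g f)"

locale is_functor = C: is_category C + D: is_category D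
  for C :: "('o, 'm) category" and D :: "('p, 'n) category" +
  fixes F :: "'o \<Rightarrow> 'p" and G :: "'o \<Rightarrow> 'o \<Rightarrow> 'm \<Rightarrow> 'n"
  assumes obj_map: "X \<in> cobj C \<Longrightarrow> F X \<in> cobj D"
    and hom_map: "\<lbrakk>X \<in> cobj C; Y \<in> cobj C; f \<in> chom C X Y\<rbrakk> \<Longrightarrow> G X Y f \<in> chom D (F X) (F Y)"
    and id_map: "X \<in> cobj C \<Longrightarrow> G X X (cid C X) = cid D (F X)"
    and comp_map: "\<lbrakk>X \<in> cobj C; Y \<in> cobj C; Z \<in> cobj C; f \<in> chom C X Y; g \<in> chom C Y Z\<rbrakk>
      \<Longrightarrow> G X Z (ccomp C X Y Z g f) = ccomp D (F X) (F Y) (F Z) (G Y Z g) (G X Y f)"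

text \<open>In both categories the objects have their carriers in an arbitrary type, which plays
  the role of the universe. Morphisms are made extensional, so that functions agreeing on the
  carrier are the same morphism.\<close>
definition CRig_g :: "('u ring, 'u \<Rightarrow> 'u) category" where
  "CRig_g = \<lparr>cobj = {S. ft_g_semiring S},
     chom = (\<lambda>S T. g_hom S T \<inter> extensional (carrier S)),
     cid = (\<lambda>S. \<lambda>x\<in>carrier S. x),
     ccomp = (\<lambda>S T U g f. compose (carrier S) g f)\<rparr>"

definition CohFrm :: "('l gorder, 'l \<Rightarrow> 'l) category" where
  "CohFrm = \<lparr>cobj = {L. coherent_frame L},
     chom = (\<lambda>L M. coherent_frame_hom L M \<inter> extensional (carrier L)),
     cid = (\<lambda>L. \<lambda>x\<in>carrier L. x),
     ccomp = (\<lambda>L M N g f. compose (carrier L) g f)\<rparr>"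

end

theory Submission
  imports Defs
begin

text \<open>
  \<open>Id_g_map S T \<phi>\<close> sends \<open>I\<close> to the least g-closed ideal containing \<open>\<phi> ` I\<close>. Since inverse images
  of g-closed ideals are g-closed, it is left adjoint to \<open>J \<mapsto> \<phi> -` J \<inter> carrier S\<close>, hence preserves
  joins, and the adjunction also gives \<open>\<langle>a\<rangle>\<^sub>g \<mapsto> \<langle>\<phi>(a)\<rangle>\<^sub>g\<close>. Every g-closed ideal is the join of the
  principal ones it contains, so frame distributivity and \<open>G4\<close> reduce binary meets to
  \<open>\<phi>(ab) = \<phi>(a)\<phi>(b)\<close>; functoriality is likewise checked on principal closures.
\<close>

lemma (in complete_lattice) inf_eqI:
  assumes "A \<subseteq> carrier L" "x \<in> carrier L" "\<And>a. a \<in> A \<Longrightarrow> x \<sqsubseteq> a"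
    and "\<And>y. y \<in> carrier L \<Longrightarrow> (\<And>a. a \<in> A \<Longrightarrow> y \<sqsubseteq> a) \<Longrightarrow> y \<sqsubseteq> x"
  shows "\<Sqinter> A = x"
  using assms by (intro le_antisym inf_greatest assms(4) inf_lower) auto

section \<open>The operator \<open>g_cl\<close> as a closure operator, and principal
  g-closures\<close>

context comm_semiring
begin

text \<open>Adding two pairs \<open>(a, \<zero>)\<close> and \<open>(b, \<zero>)\<close> gives
  closure under sums. Multiplying \<open>(a, \<zero>)\<close> by the reflexive pair
  \<open>(s, s)\<close> gives absorption, because
  \<open>s \<otimes> \<zero> = \<zero>\<close>.\<close>

lemma sr_ideal_zero_class:
  assumes "sr_congruence S \<theta>"
  shows "sr_ideal S (zero_class S \<theta>)"
proof -
  have eq: "equiv (carrier S) \<theta>"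
    and add: "\<And>a b c d. (a, b) \<in> \<theta> \<Longrightarrow> (c, d) \<in> \<theta> \<Longrightarrow> (a \<oplus> c, b \<oplus> d) \<in> \<theta>"
    and mult: "\<And>a b c d. (a, b) \<in> \<theta> \<Longrightarrow> (c, d) \<in> \<theta> \<Longrightarrow> (a \<otimes> c, b \<otimes> d) \<in> \<theta>"
    using assms by (fastforce simp: sr_congruence_def)+
  have sub: "\<theta> \<subseteq> carrier S \<times> carrier S" and refl: "\<And>a. a \<in> carrier S \<Longrightarrow> (a, a) \<in> \<theta>"
    using eq by (auto simp: equiv_def refl_on_def)
  show ?thesis
    unfolding sr_ideal_def zero_class_def
  proof (intro conjI ballI)
    show "{a. (a, \<zero>) \<in> \<theta>} \<noteq> {}"
      using refl[of \<zero>] by blast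
  qed (use sub refl add[of _ \<zero> _ \<zero>] mult[of s s _ \<zero> for s] in \<open>auto simp: subset_iff\<close>)
qed

text \<open>Taking the zero class commutes with intersecting congruences. The closure is thus an
  intersection of zero classes inside the carrier, and its order properties follow from this
  form.\<close>

lemma mem_g_cl_iff:
  "x \<in> g_cl S I \<longleftrightarrow> x \<in> carrier S \<and>
     (\<forall>\<theta>. max_congruence S \<theta> \<and> I \<subseteq> zero_class S \<theta> \<longrightarrow> x \<in> zero_class S \<theta>)"
  by (auto simp: g_cl_def wp_def zero_class_def)

lemma g_cl_subset_carrier: "g_cl S I \<subseteq> carrier S"
  by (auto simp: mem_g_cl_iff)

lemma g_cl_extensive: "I \<subseteq> carrier S \<Longrightarrow> I \<subseteq> g_cl S I"
  by (auto simp: mem_g_cl_iff)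

lemma g_cl_mono: "I \<subseteq> J \<Longrightarrow> g_cl S I \<subseteq> g_cl S J"
  unfolding mem_g_cl_iff subset_iff by blast

text \<open>Each zero class in the intersection is an ideal, and all of them share
  \<open>\<zero>\<close>. No ideal property of \<open>I\<close> itself enters.\<close>

lemma sr_ideal_g_cl: "sr_ideal S (g_cl S I)"
proof -
  have id: "sr_ideal S (zero_class S \<theta>)" if "max_congruence S \<theta>" for \<theta>
    using that sr_ideal_zero_class by (simp add: max_congruence_def)
  have zero: "\<zero> \<in> zero_class S \<theta>" if "max_congruence S \<theta>" for \<theta>
    using that by (auto simp: max_congruence_def sr_congruence_def zero_class_def equiv_def refl_on_def)
  have "\<zero> \<in> g_cl S I"
    using zero by (simp add: mem_g_cl_iff)
  moreover have "a \<oplus> b \<in> g_cl S I" if "a \<in> g_cl S I" "b \<in> g_cl S I" for a b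
    using that id by (simp add: mem_g_cl_iff sr_ideal_def)
  moreover have "s \<otimes> a \<in> g_cl S I" if "s \<in> carrier S" "a \<in> g_cl S I" for s a
    using that id by (simp add: mem_g_cl_iff sr_ideal_def)
  ultimately show ?thesis
    unfolding sr_ideal_def using g_cl_subset_carrier by blast
qed

text \<open>A maximal congruence whose zero class contains \<open>I\<close> has a zero class
  containing \<open>g_cl S I\<close> as well, so both closures intersect the same zero
  classes.\<close>

lemma g_cl_idem: "g_cl S (g_cl S I) = g_cl S I"
proof
  show "g_cl S (g_cl S I) \<subseteq> g_cl S I"
    by (smt (verit) mem_g_cl_iff subset_iff)
qed (intro g_cl_extensive g_cl_subset_carrier)

lemma g_closed_g_cl: "g_closed S (g_cl S I)"
  by (simp add: g_closed_def sr_ideal_g_cl g_cl_idem)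

lemma g_closed_subset_carrier: "g_closed S I \<Longrightarrow> I \<subseteq> carrier S"
  by (simp add: g_closed_def sr_ideal_def)

lemma g_closed_carrier: "g_closed S (carrier S)"
  using g_closed_g_cl[of "carrier S"] g_cl_extensive[of "carrier S"] g_cl_subset_carrier
  by (metis order_refl subset_antisym)

text \<open>By monotonicity the closure of the intersection lies in every member. The factor
  \<open>carrier S\<close> makes the empty family yield the whole semiring, the empty meet.\<close>

lemma g_closed_Inter:
  assumes "\<And>I. I \<in> \<I> \<Longrightarrow> g_closed S I"
  shows "g_closed S (carrier S \<inter> \<Inter>\<I>)"
proof -
  have "g_cl S (carrier S \<inter> \<Inter>\<I>) \<subseteq> I" if "I \<in> \<I>" for I
    using g_cl_mono[of "carrier S \<inter> \<Inter>\<I>" I] assms[OF that] that by (auto simp: g_closed_def)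
  then have "g_cl S (carrier S \<inter> \<Inter>\<I>) = carrier S \<inter> \<Inter>\<I>"
    using g_cl_subset_carrier g_cl_extensive[of "carrier S \<inter> \<Inter>\<I>"] by blast
  then show ?thesis
    using g_closed_g_cl[of "carrier S \<inter> \<Inter>\<I>"] by simp
qed

lemma g_closed_g_prin: "g_closed S (g_prin S a)"
  by (simp add: g_prin_def g_closed_g_cl)

lemma mem_g_prin: "a \<in> carrier S \<Longrightarrow> a \<in> g_prin S a"
  unfolding g_prin_def mem_g_cl_iff gen_ideal_def
  using sr_ideal_zero_class by (auto simp: max_congruence_def)

text \<open>The universal property of a principal g-closure: later inclusions between g-closed
  ideals reduce to membership of single elements.\<close>

lemma g_prin_subset_iff:
  assumes "a \<in> carrier S" "g_closed S I"
  shows "g_prin S a \<subseteq> I \<longleftrightarrow> a \<in> I"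
proof
  assume "a \<in> I"
  then have "gen_ideal S {a} \<subseteq> I"
    using assms(2) by (auto simp: gen_ideal_def g_closed_def)
  then show "g_prin S a \<subseteq> I"
    using g_cl_mono assms(2) unfolding g_prin_def g_closed_def by metis
qed (use mem_g_prin[OF assms(1)] in blast)

lemma g_closed_one: "\<lbrakk>g_closed S I; \<one> \<in> I\<rbrakk> \<Longrightarrow> I = carrier S"
  unfolding g_closed_def sr_ideal_def using m_comm r_one by (metis subsetI subset_antisym)

end

section \<open>The frame of g-closed ideals and its coherence\<close>

lemma carrier_Id_g: "carrier (Id_g S) = {I. g_closed S I}"
  and le_Id_g: "I \<sqsubseteq>\<^bsub>Id_g S\<^esub> J \<longleftrightarrow> I \<subseteq> J"
  by (simp_all add: Id_g_def)

context ft_g_semiring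
begin

sublocale Idg: frame "Id_g S"
  by (rule G2_frame)

lemma Idg_sup_subset_iff:
  assumes "\<I> \<subseteq> Collect (g_closed S)" "g_closed S J"
  shows "\<Squnion>\<^bsub>Id_g S\<^esub> \<I> \<subseteq> J \<longleftrightarrow> (\<forall>I\<in>\<I>. I \<subseteq> J)"
  using Idg.sup_upper[of \<I>] Idg.sup_least[of \<I> J] assms
  by (auto simp: carrier_Id_g le_Id_g)

lemma g_closed_Idg_sup: "\<I> \<subseteq> Collect (g_closed S) \<Longrightarrow> g_closed S (\<Squnion>\<^bsub>Id_g S\<^esub> \<I>)"
  using Idg.sup_closed[of \<I>] by (simp add: carrier_Id_g)

lemma Idg_sup_upper: "\<lbrakk>\<I> \<subseteq> Collect (g_closed S); I \<in> \<I>\<rbrakk> \<Longrightarrow> I \<subseteq> \<Squnion>\<^bsub>Id_g S\<^esub> \<I>"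
  using Idg_sup_subset_iff[of \<I>] g_closed_Idg_sup by blast

text \<open>A g-closed ideal is determined by the g-closed ideals that contain it, so a join can be
  identified by its upper bounds without computing any sum of ideals.\<close>

lemma Idg_sup_eqI:
  assumes "\<I> \<subseteq> Collect (g_closed S)" "g_closed S K"
    and "\<And>J. g_closed S J \<Longrightarrow> K \<subseteq> J \<longleftrightarrow> (\<forall>I\<in>\<I>. I \<subseteq> J)"
  shows "\<Squnion>\<^bsub>Id_g S\<^esub> \<I> = K"
  using assms Idg_sup_subset_iff g_closed_Idg_sup by (metis order_refl subset_antisym)

text \<open>\<open>G2_meet\<close> speaks of binary meets only; arbitrary ones, the empty one
  included, come from stability of g-closed ideals under intersection.\<close>

lemma Idg_inf: "\<I> \<subseteq> Collect (g_closed S) \<Longrightarrow> \<Sqinter>\<^bsub>Id_g S\<^esub> \<I> = carrier S \<inter> \<Inter>\<I>"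
  using g_closed_Inter[of \<I>] g_closed_subset_carrier
  by (intro Idg.inf_eqI) (fastforce simp: carrier_Id_g le_Id_g)+

lemma Idg_top: "\<top>\<^bsub>Id_g S\<^esub> = carrier S"
  using Idg_inf[of "{}"] Idg.weak_inf_empty by (simp add: Id_g_def)

lemma Idg_inter_sup_distrib:
  assumes "g_closed S I" "\<I> \<subseteq> Collect (g_closed S)"
  shows "I \<inter> \<Squnion>\<^bsub>Id_g S\<^esub> \<I> = \<Squnion>\<^bsub>Id_g S\<^esub> ((\<lambda>J. I \<inter> J) ` \<I>)"
proof -
  have "(\<lambda>J. I \<sqinter>\<^bsub>Id_g S\<^esub> J) ` \<I> = (\<lambda>J. I \<inter> J) ` \<I>"
    using assms G2_meet by (intro image_cong) auto
  then show ?thesis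
    using Idg.meet_sup_distrib[of I \<I>] G2_meet[OF assms(1) g_closed_Idg_sup] assms
    by (simp add: carrier_Id_g)
qed

lemma g_prin_family: "g_prin S ` A \<subseteq> Collect (g_closed S)"
  using g_closed_g_prin by auto

lemma g_join_g_prin: "g_join S (g_prin S ` A) = \<Squnion>\<^bsub>Id_g S\<^esub> (g_prin S ` A)"
  using G2_join[of "g_prin S ` A"] g_prin_family by (simp add: carrier_Id_g)

lemma g_closed_inter: "\<lbrakk>g_closed S I; g_closed S J\<rbrakk> \<Longrightarrow> g_closed S (I \<inter> J)"
  using g_closed_Inter[of "{I, J}"] g_closed_subset_carrier[of I]
  by (auto simp: Int_absorb1 Int_assoc[symmetric])

text \<open>Distributing over both joins leaves the terms
  \<open>g_prin S a \<inter> g_prin S b\<close>, which \<open>G4\<close> turns into principal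
  closures of products. Both the coherence of the frame and the preservation of binary meets rest on
  this formula.\<close>

lemma sup_g_prin_inter:
  assumes "A \<subseteq> carrier S" "B \<subseteq> carrier S"
  shows "\<Squnion>\<^bsub>Id_g S\<^esub> (g_prin S ` A) \<inter> \<Squnion>\<^bsub>Id_g S\<^esub> (g_prin S ` B) =
    \<Squnion>\<^bsub>Id_g S\<^esub> (g_prin S ` {a \<otimes> b | a b. a \<in> A \<and> b \<in> B})"
    (is "?A \<inter> ?B = ?C")
proof
  have cl: "g_closed S ?A" "g_closed S ?B" "g_closed S ?C"
    by (simp_all add: g_closed_Idg_sup g_prin_family)
  \<comment> \<open>First distribution: \<open>a\<close> is fixed and the join over \<open>B\<close>
    is opened. The join over \<open>A\<close> is opened afterwards.\<close>
  have *: "g_prin S a \<inter> ?B \<subseteq> ?C" if "a \<in> A" for a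
  proof -
    have "g_prin S a \<inter> g_prin S b \<subseteq> ?C" if "b \<in> B" for b
      using that \<open>a \<in> A\<close> assms by (subst G4) (blast intro!: Idg_sup_upper[OF g_prin_family])+
    then show ?thesis
      using cl g_prin_family g_closed_inter g_closed_g_prin
      by (subst Idg_inter_sup_distrib) (auto simp: Idg_sup_subset_iff image_subset_iff)
  qed
  have "?B \<inter> ?A \<subseteq> ?C"
    using * cl g_prin_family g_closed_inter g_closed_g_prin
    by (subst Idg_inter_sup_distrib)
       (auto simp: Idg_sup_subset_iff image_subset_iff Int_commute)
  then show "?A \<inter> ?B \<subseteq> ?C"
    by (simp add: Int_commute)
  show "?C \<subseteq> ?A \<inter> ?B"
  proof (subst Idg_sup_subset_iff[OF g_prin_family])
    show "g_closed S (?A \<inter> ?B)"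
      using cl g_closed_inter by blast
    show "\<forall>I \<in> g_prin S ` {a \<otimes> b | a b. a \<in> A \<and> b \<in> B}. I \<subseteq> ?A \<inter> ?B"
    proof clarify
      fix a b x assume ab: "a \<in> A" "b \<in> B" and x: "x \<in> g_prin S (a \<otimes> b)"
      \<comment> \<open>\<open>G4\<close> read backwards: the closure of a product lies below the
        closures of both factors.\<close>
      have "x \<in> g_prin S a" "x \<in> g_prin S b"
        using x ab assms G4[of a b] by auto
      then show "x \<in> ?A \<inter> ?B"
        using ab Idg_sup_upper[OF g_prin_family] by blast
    qed
  qed
qed

text \<open>A g-closed ideal contains all \<open>g_prin S a\<close> with \<open>a \<in> I\<close>
  exactly when it contains all these \<open>a\<close>.\<close>

lemma sup_g_prin_self:
  assumes "g_closed S I"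
  shows "\<Squnion>\<^bsub>Id_g S\<^esub> (g_prin S ` I) = I"
proof (intro Idg_sup_eqI g_prin_family assms)
  fix J assume "g_closed S J"
  then have "g_prin S a \<subseteq> J \<longleftrightarrow> a \<in> J" if "a \<in> I" for a
    using that g_closed_subset_carrier[OF assms] g_prin_subset_iff by blast
  then show "I \<subseteq> J \<longleftrightarrow> (\<forall>K\<in>g_prin S ` I. K \<subseteq> J)"
    by (simp add: subset_eq[of I])
qed

text \<open>\<open>G3\<close> restated with lattice joins, so that the results on joins of principal
  closures apply to compact elements.\<close>

lemma compact_iff:
  "K \<in> compact_elems (Id_g S) \<longleftrightarrow>
     (\<exists>A. finite A \<and> A \<subseteq> carrier S \<and> K = \<Squnion>\<^bsub>Id_g S\<^esub> (g_prin S ` A))"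
  unfolding G3 g_join_g_prin by blast

lemma g_prin_compact:
  assumes "a \<in> carrier S"
  shows "g_prin S a \<in> compact_elems (Id_g S)"
proof -
  have "\<Squnion>\<^bsub>Id_g S\<^esub> (g_prin S ` {a}) = g_prin S a"
    using g_closed_g_prin by (intro Idg_sup_eqI) auto
  then show ?thesis
    unfolding compact_iff using assms by (metis empty_subsetI finite.intros insert_subset)
qed

lemma coherent_frame_Id_g: "coherent_frame (Id_g S)"
proof
  \<comment> \<open>The top is the principal closure of \<open>\<one>\<close>, hence
    compact.\<close>
  have "g_prin S \<one> = carrier S"
    using g_closed_one[OF g_closed_g_prin mem_g_prin] by simp
  then show "\<top>\<^bsub>Id_g S\<^esub> \<in> compact_elems (Id_g S)"
    using g_prin_compact[of \<one>] by (simp add: Idg_top)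
next
  fix I assume "I \<in> carrier (Id_g S)"
  then have "g_closed S I"
    by (simp add: carrier_Id_g)
  then have "g_prin S ` I \<subseteq> compact_elems (Id_g S)" "I = \<Squnion>\<^bsub>Id_g S\<^esub> (g_prin S ` I)"
    using g_closed_subset_carrier g_prin_compact sup_g_prin_self by auto
  then show "\<exists>A\<subseteq>compact_elems (Id_g S). I = \<Squnion>\<^bsub>Id_g S\<^esub> A"
    by blast
next
  fix I J assume "I \<in> compact_elems (Id_g S)" "J \<in> compact_elems (Id_g S)"
  then obtain A B where A: "finite A" "A \<subseteq> carrier S" "I = \<Squnion>\<^bsub>Id_g S\<^esub> (g_prin S ` A)"
    and B: "finite B" "B \<subseteq> carrier S" "J = \<Squnion>\<^bsub>Id_g S\<^esub> (g_prin S ` B)"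
    unfolding compact_iff by blast
  have "I \<sqinter>\<^bsub>Id_g S\<^esub> J = I \<inter> J"
    using A(3) B(3) g_closed_Idg_sup[OF g_prin_family] by (simp add: G2_meet)
  also have "\<dots> = \<Squnion>\<^bsub>Id_g S\<^esub> (g_prin S ` {a \<otimes> b | a b. a \<in> A \<and> b \<in> B})"
    using A B by (simp add: sup_g_prin_inter)
  finally show "I \<sqinter>\<^bsub>Id_g S\<^esub> J \<in> compact_elems (Id_g S)"
    \<comment> \<open>Finitely many generators on each side have only finitely many pairwise
      products.\<close>
    unfolding compact_iff using A B finite_image_set2[of "\<lambda>a. a \<in> A" "\<lambda>b. b \<in> B" "(\<otimes>)"]
    by (intro exI[of _ "{a \<otimes> b | a b. a \<in> A \<and> b \<in> B}"]) auto
qed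

end

section \<open>The coherent frame homomorphism induced by a morphism of semirings\<close>

locale g_hom_pair = S: ft_g_semiring S + T: ft_g_semiring T
  for S :: "('a, 'm) ring_scheme" and T :: "('b, 'n) ring_scheme" +
  fixes \<phi> :: "'a \<Rightarrow> 'b"
  assumes g_hom: "\<phi> \<in> g_hom S T"
begin

lemma hom_closed: "a \<in> carrier S \<Longrightarrow> \<phi> a \<in> carrier T"
  and hom_mult: "\<lbrakk>a \<in> carrier S; b \<in> carrier S\<rbrakk> \<Longrightarrow> \<phi> (a \<otimes>\<^bsub>S\<^esub> b) = \<phi> a \<otimes>\<^bsub>T\<^esub> \<phi> b"
  and hom_one: "\<phi> \<one>\<^bsub>S\<^esub> = \<one>\<^bsub>T\<^esub>"
  and g_closed_vimage: "g_closed T J \<Longrightarrow> g_closed S (\<phi> -` J \<inter> carrier S)"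
  using g_hom by (auto simp: g_hom_def sr_hom_def ring_hom_def)

lemma Id_g_map_eq:
  assumes "g_closed S I"
  shows "Id_g_map S T \<phi> I = \<Squnion>\<^bsub>Id_g T\<^esub> (g_prin T ` \<phi> ` I)"
  using assms T.g_join_g_prin[of "\<phi> ` I"]
  by (simp add: Id_g_map_def carrier_Id_g image_image)

lemma g_closed_Id_g_map: "g_closed S I \<Longrightarrow> g_closed T (Id_g_map S T \<phi> I)"
  by (simp add: Id_g_map_eq T.g_closed_Idg_sup T.g_prin_family)

lemma Id_g_map_subset_iff:
  assumes "g_closed S I" "g_closed T J"
  shows "Id_g_map S T \<phi> I \<subseteq> J \<longleftrightarrow> \<phi> ` I \<subseteq> J"
proof -
  have "g_prin T (\<phi> a) \<subseteq> J \<longleftrightarrow> \<phi> a \<in> J" if "a \<in> I" for a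
    using that S.g_closed_subset_carrier[OF assms(1)] hom_closed assms(2) T.g_prin_subset_iff
    by blast
  then show ?thesis
    using assms by (simp add: Id_g_map_eq T.Idg_sup_subset_iff[OF T.g_prin_family] image_subset_iff)
qed

lemma image_subset_Id_g_map: "g_closed S I \<Longrightarrow> \<phi> ` I \<subseteq> Id_g_map S T \<phi> I"
  using Id_g_map_subset_iff g_closed_Id_g_map by blast

text \<open>As pullbacks of g-closed ideals are g-closed, this is an adjunction between the two
  posets, with the induced map on the left.\<close>

lemma Id_g_map_adjoint:
  assumes "g_closed S I" "g_closed T J"
  shows "Id_g_map S T \<phi> I \<subseteq> J \<longleftrightarrow> I \<subseteq> \<phi> -` J \<inter> carrier S"
  using Id_g_map_subset_iff[OF assms] S.g_closed_subset_carrier[OF assms(1)] by auto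

lemma Id_g_map_sup:
  assumes "\<I> \<subseteq> Collect (g_closed S)"
  shows "Id_g_map S T \<phi> (\<Squnion>\<^bsub>Id_g S\<^esub> \<I>) = \<Squnion>\<^bsub>Id_g T\<^esub> (Id_g_map S T \<phi> ` \<I>)"
proof (rule T.Idg_sup_eqI[symmetric])
  show "Id_g_map S T \<phi> ` \<I> \<subseteq> Collect (g_closed T)"
    using assms g_closed_Id_g_map by auto
  show "g_closed T (Id_g_map S T \<phi> (\<Squnion>\<^bsub>Id_g S\<^esub> \<I>))"
    using assms by (simp add: g_closed_Id_g_map S.g_closed_Idg_sup)
  fix J assume J: "g_closed T J"
  \<comment> \<open>The pullback of \<open>J\<close> is g-closed, so it bounds the join as soon as
    it bounds every member.\<close>
  have "Id_g_map S T \<phi> (\<Squnion>\<^bsub>Id_g S\<^esub> \<I>) \<subseteq> J \<longleftrightarrow> (\<forall>I\<in>\<I>. I \<subseteq> \<phi> -` J \<inter> carrier S)"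
    using assms J by (simp only: Id_g_map_adjoint S.g_closed_Idg_sup S.Idg_sup_subset_iff g_closed_vimage)
  also have "\<dots> \<longleftrightarrow> (\<forall>I\<in>\<I>. Id_g_map S T \<phi> I \<subseteq> J)"
    using assms J Id_g_map_adjoint by blast
  finally show "Id_g_map S T \<phi> (\<Squnion>\<^bsub>Id_g S\<^esub> \<I>) \<subseteq> J \<longleftrightarrow> (\<forall>K\<in>Id_g_map S T \<phi> ` \<I>. K \<subseteq> J)"
    by simp
qed

text \<open>One inclusion holds because the image ideal contains \<open>\<phi> a\<close>. By
  adjunction the other says that the pullback of \<open>g_prin T (\<phi> a)\<close> contains
  \<open>a\<close>.\<close>

lemma Id_g_map_g_prin:
  assumes "a \<in> carrier S"
  shows "Id_g_map S T \<phi> (g_prin S a) = g_prin T (\<phi> a)"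
proof (rule subset_antisym)
  have "\<phi> a \<in> Id_g_map S T \<phi> (g_prin S a)"
    using assms image_subset_Id_g_map S.g_closed_g_prin S.mem_g_prin by blast
  then show "g_prin T (\<phi> a) \<subseteq> Id_g_map S T \<phi> (g_prin S a)"
    using assms by (simp add: T.g_prin_subset_iff hom_closed g_closed_Id_g_map S.g_closed_g_prin)
  show "Id_g_map S T \<phi> (g_prin S a) \<subseteq> g_prin T (\<phi> a)"
    unfolding Id_g_map_adjoint[OF S.g_closed_g_prin T.g_closed_g_prin]
      S.g_prin_subset_iff[OF assms g_closed_vimage[OF T.g_closed_g_prin]]
    using assms hom_closed T.mem_g_prin by simp
qed

text \<open>The map acts on generators of a join by \<open>\<phi>\<close>. Binary meets, compact
  elements and composites are all handled through this formula.\<close>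

lemma Id_g_map_sup_g_prin:
  assumes "A \<subseteq> carrier S"
  shows "Id_g_map S T \<phi> (\<Squnion>\<^bsub>Id_g S\<^esub> (g_prin S ` A)) = \<Squnion>\<^bsub>Id_g T\<^esub> (g_prin T ` \<phi> ` A)"
proof -
  have "Id_g_map S T \<phi> ` g_prin S ` A = g_prin T ` \<phi> ` A"
    unfolding image_image using assms Id_g_map_g_prin by (intro image_cong) auto
  then show ?thesis
    by (simp add: Id_g_map_sup S.g_prin_family)
qed

text \<open>With \<open>I\<close> and \<open>J\<close> written as joins of principal closures, the
  intersection is generated by products \<open>a \<otimes> b\<close>. These map to products of
  images, which generate the intersection on the side of \<open>T\<close>.\<close>

lemma Id_g_map_inter:
  assumes "g_closed S I" "g_closed S J"
  shows "Id_g_map S T \<phi> (I \<inter> J) = Id_g_map S T \<phi> I \<inter> Id_g_map S T \<phi> J"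
proof -
  have sub: "I \<subseteq> carrier S" "J \<subseteq> carrier S"
    using assms S.g_closed_subset_carrier by auto
  let ?P = "{a \<otimes>\<^bsub>S\<^esub> b | a b. a \<in> I \<and> b \<in> J}"
  have P: "\<phi> ` ?P = {a \<otimes>\<^bsub>T\<^esub> b | a b. a \<in> \<phi> ` I \<and> b \<in> \<phi> ` J}"
  proof -
    have "\<phi> (a \<otimes>\<^bsub>S\<^esub> b) = \<phi> a \<otimes>\<^bsub>T\<^esub> \<phi> b" if "a \<in> I" "b \<in> J" for a b
      using that sub hom_mult by blast
    then show ?thesis by (fastforce simp: image_iff)
  qed
  have "I \<inter> J = \<Squnion>\<^bsub>Id_g S\<^esub> (g_prin S ` ?P)"
    using S.sup_g_prin_inter[OF sub] assms by (simp add: S.sup_g_prin_self)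
  then have "Id_g_map S T \<phi> (I \<inter> J) = \<Squnion>\<^bsub>Id_g T\<^esub> (g_prin T ` \<phi> ` ?P)"
    using sub by (subst Id_g_map_sup_g_prin[symmetric]) auto
  also have "\<dots> = Id_g_map S T \<phi> I \<inter> Id_g_map S T \<phi> J"
  proof -
    have "\<phi> ` I \<subseteq> carrier T" "\<phi> ` J \<subseteq> carrier T"
      using sub hom_closed by auto
    then show ?thesis
      using assms by (simp only: P Id_g_map_eq T.sup_g_prin_inter)
  qed
  finally show ?thesis .
qed

text \<open>The image ideal contains \<open>\<phi> \<one> = \<one>\<close>. This is the empty case
  of preservation of finite meets.\<close>

lemma Id_g_map_carrier: "Id_g_map S T \<phi> (carrier S) = carrier T"
  using T.g_closed_one[OF g_closed_Id_g_map[OF S.g_closed_carrier]]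
    image_subset_Id_g_map[OF S.g_closed_carrier] hom_one
  by (metis S.one_closed image_subset_iff)

lemma Id_g_map_Inter:
  assumes "finite \<I>" "\<I> \<subseteq> Collect (g_closed S)"
  shows "Id_g_map S T \<phi> (carrier S \<inter> \<Inter>\<I>) = carrier T \<inter> \<Inter>(Id_g_map S T \<phi> ` \<I>)"
  using assms
proof (induction \<I> rule: finite_induct)
  case empty
  then show ?case by (simp add: Id_g_map_carrier)
next
  case (insert I \<I>)
  have "carrier S \<inter> \<Inter>(insert I \<I>) = I \<inter> (carrier S \<inter> \<Inter>\<I>)"
    by auto
  also have "Id_g_map S T \<phi> \<dots> = Id_g_map S T \<phi> I \<inter> Id_g_map S T \<phi> (carrier S \<inter> \<Inter>\<I>)"
    using insert.prems by (intro Id_g_map_inter S.g_closed_Inter) auto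
  also have "\<dots> = carrier T \<inter> \<Inter>(Id_g_map S T \<phi> ` insert I \<I>)"
    using insert by auto
  finally show ?case .
qed

lemma Id_g_map_coherent: "Id_g_map S T \<phi> \<in> coherent_frame_hom (Id_g S) (Id_g T)"
  unfolding coherent_frame_hom_def mem_Collect_eq
proof (intro conjI allI impI)
  show "Id_g_map S T \<phi> \<in> carrier (Id_g S) \<rightarrow> carrier (Id_g T)"
    by (simp add: carrier_Id_g g_closed_Id_g_map)
next
  fix A assume "A \<subseteq> carrier (Id_g S)"
  then show "Id_g_map S T \<phi> (\<Squnion>\<^bsub>Id_g S\<^esub> A) = \<Squnion>\<^bsub>Id_g T\<^esub> (Id_g_map S T \<phi> ` A)"
    by (simp add: carrier_Id_g Id_g_map_sup)
next
  fix A assume A: "A \<subseteq> carrier (Id_g S)" "finite A"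
  then have "Id_g_map S T \<phi> ` A \<subseteq> Collect (g_closed T)"
    using g_closed_Id_g_map by (auto simp: carrier_Id_g)
  then show "Id_g_map S T \<phi> (\<Sqinter>\<^bsub>Id_g S\<^esub> A) = \<Sqinter>\<^bsub>Id_g T\<^esub> (Id_g_map S T \<phi> ` A)"
    using A by (simp add: carrier_Id_g S.Idg_inf T.Idg_inf Id_g_map_Inter)
next
  show "Id_g_map S T \<phi> ` compact_elems (Id_g S) \<subseteq> compact_elems (Id_g T)"
  proof clarify
    fix K assume "K \<in> compact_elems (Id_g S)"
    then obtain A where A: "finite A" "A \<subseteq> carrier S" "K = \<Squnion>\<^bsub>Id_g S\<^esub> (g_prin S ` A)"
      unfolding S.compact_iff by blast
    then show "Id_g_map S T \<phi> K \<in> compact_elems (Id_g T)"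
      \<comment> \<open>Images of finitely many generators again form a finite generating
        set.\<close>
      unfolding T.compact_iff using hom_closed
      by (intro exI[of _ "\<phi> ` A"]) (auto simp: Id_g_map_sup_g_prin)
  qed
qed

end

section \<open>Identities and composites in the two categories\<close>

lemma vimage_restrict_id: "J \<subseteq> A \<Longrightarrow> (\<lambda>x\<in>A. x) -` J \<inter> A = J"
  by auto

lemma vimage_compose:
  "f \<in> A \<rightarrow> B \<Longrightarrow> compose A g f -` J \<inter> A = f -` (g -` J \<inter> B) \<inter> A"
  by (auto simp: compose_def)

lemma (in comm_semiring) g_hom_id: "(\<lambda>x\<in>carrier S. x) \<in> g_hom S S"
proof -
  have "z_ideal S J \<Longrightarrow> J \<subseteq> carrier S" for J
    by (simp add: z_ideal_def sr_ideal_def)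
  then show ?thesis
    using g_closed_subset_carrier
    by (simp add: g_hom_def vimage_restrict_id) (simp add: sr_hom_def ring_hom_def)
qed

lemma g_hom_compose:
  assumes S: "comm_semiring S" and f: "f \<in> g_hom S T" and g: "g \<in> g_hom T U"
  shows "compose (carrier S) g f \<in> g_hom S U"
proof -
  interpret comm_semiring S by (rule S)
  have fc: "f \<in> carrier S \<rightarrow> carrier T"
    using f by (simp add: g_hom_def sr_hom_def ring_hom_def)
  have "compose (carrier S) g f \<in> sr_hom S U"
    using f g fc by (simp add: g_hom_def sr_hom_def ring_hom_def compose_def Pi_iff)
  then show ?thesis
    using f g by (simp add: g_hom_def vimage_compose[OF fc] del: vimage_Int)
qed

lemma is_category_CRig_g: "is_category CRig_g"
proof
  fix X :: "'a ring" assume X: "X \<in> cobj CRig_g"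
  then interpret ft_g_semiring X by (simp add: CRig_g_def)
  show "cid CRig_g X \<in> chom CRig_g X X"
    using g_hom_id by (simp add: CRig_g_def)
next
  fix X Y Z :: "'a ring" and f g :: "'a \<Rightarrow> 'a"
  assume "X \<in> cobj CRig_g" "f \<in> chom CRig_g X Y" "g \<in> chom CRig_g Y Z"
  then show "ccomp CRig_g X Y Z g f \<in> chom CRig_g X Z"
    using g_hom_compose[of X f Y g Z] by (simp add: CRig_g_def ft_g_semiring_def)
next
  fix X Y :: "'a ring" and f :: "'a \<Rightarrow> 'a"
  assume "f \<in> chom CRig_g X Y"
  then have f: "f \<in> carrier X \<rightarrow> carrier Y" "f \<in> extensional (carrier X)"
    by (simp_all add: CRig_g_def g_hom_def sr_hom_def ring_hom_def)
  \<comment> \<open>Off the carrier both sides are \<open>undefined\<close>, since \<open>f\<close>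
    is extensional.\<close>
  show "ccomp CRig_g X X Y f (cid CRig_g X) = f"
    using f by (auto simp: CRig_g_def compose_def fun_eq_iff extensional_def)
  show "ccomp CRig_g X Y Y (cid CRig_g Y) f = f"
    using f by (auto simp: CRig_g_def compose_def fun_eq_iff extensional_def)
next
  fix W X Y Z :: "'a ring" and f g h :: "'a \<Rightarrow> 'a"
  assume "f \<in> chom CRig_g W X"
  \<comment> \<open>The composite of \<open>g\<close> and \<open>h\<close> is
    \<open>undefined\<close> off \<open>carrier X\<close>, so \<open>f\<close> must land
    there.\<close>
  then have "f \<in> carrier W \<rightarrow> carrier X"
    by (simp add: CRig_g_def g_hom_def sr_hom_def ring_hom_def)
  then show "ccomp CRig_g W X Z (ccomp CRig_g X Y Z h g) f
      = ccomp CRig_g W Y Z h (ccomp CRig_g W X Y g f)"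
    by (auto simp: CRig_g_def compose_def fun_eq_iff)
qed

lemma coherent_frame_hom_id:
  assumes "coherent_frame L"
  shows "(\<lambda>x\<in>carrier L. x) \<in> coherent_frame_hom L L"
proof -
  interpret coherent_frame L by (rule assms)
  have "(\<lambda>x\<in>carrier L. x) ` A = A" if "A \<subseteq> carrier L" for A
    using that by force
  then show ?thesis
    by (simp add: coherent_frame_hom_def compact_elems_def)
qed

lemma coherent_frame_hom_compose:
  assumes L: "coherent_frame L"
    and f: "f \<in> coherent_frame_hom L M" and g: "g \<in> coherent_frame_hom M N"
  shows "compose (carrier L) g f \<in> coherent_frame_hom L N"
proof -
  interpret coherent_frame L by (rule L)
  have fc: "f \<in> carrier L \<rightarrow> carrier M"
    using f by (simp add: coherent_frame_hom_def)
  have im: "compose (carrier L) g f ` A = g ` f ` A" if "A \<subseteq> carrier L" for A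
    unfolding image_image using that by (intro image_cong) (auto simp: compose_def)
  have fA: "f ` A \<subseteq> carrier M" if "A \<subseteq> carrier L" for A
    using that fc by auto
  have "compose (carrier L) g f ` compact_elems L \<subseteq> compact_elems N"
  proof -
    have "compact_elems L \<subseteq> carrier L"
      by (auto simp: compact_elems_def)
    moreover have "f ` compact_elems L \<subseteq> compact_elems M" "g ` compact_elems M \<subseteq> compact_elems N"
      using f g by (simp_all add: coherent_frame_hom_def)
    ultimately show ?thesis
      by (subst im) blast+
  qed
  moreover have "compose (carrier L) g f \<in> carrier L \<rightarrow> carrier N"
    using fc g by (simp add: coherent_frame_hom_def funcset_compose)
  ultimately show ?thesis
    unfolding coherent_frame_hom_def mem_Collect_eq
  proof (intro conjI allI impI)
    fix A assume A: "A \<subseteq> carrier L"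
    \<comment> \<open>\<open>compose\<close> agrees with \<open>g (f x)\<close> only on
      \<open>carrier L\<close>, so joins, and below also meets, are first located there.\<close>
    have "\<Squnion>\<^bsub>L\<^esub> A \<in> carrier L"
      using A by simp
    then show "compose (carrier L) g f (\<Squnion>\<^bsub>L\<^esub> A) = \<Squnion>\<^bsub>N\<^esub> (compose (carrier L) g f ` A)"
      using f g A fA[OF A] unfolding im[OF A] by (simp add: compose_def coherent_frame_hom_def)
    have "\<Sqinter>\<^bsub>L\<^esub> A \<in> carrier L"
      using A by simp
    then show "compose (carrier L) g f (\<Sqinter>\<^bsub>L\<^esub> A) = \<Sqinter>\<^bsub>N\<^esub> (compose (carrier L) g f ` A)" if "finite A"
      using f g A fA[OF A] that unfolding im[OF A] by (simp add: compose_def coherent_frame_hom_def)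
  qed
qed

lemma is_category_CohFrm: "is_category CohFrm"
proof
  fix X :: "'a gorder" assume "X \<in> cobj CohFrm"
  then show "cid CohFrm X \<in> chom CohFrm X X"
    using coherent_frame_hom_id by (simp add: CohFrm_def)
next
  fix X Y Z :: "'a gorder" and f g :: "'a \<Rightarrow> 'a"
  assume "X \<in> cobj CohFrm" "f \<in> chom CohFrm X Y" "g \<in> chom CohFrm Y Z"
  then show "ccomp CohFrm X Y Z g f \<in> chom CohFrm X Z"
    using coherent_frame_hom_compose[of X f Y g Z] by (simp add: CohFrm_def)
next
  fix X Y :: "'a gorder" and f :: "'a \<Rightarrow> 'a"
  assume "f \<in> chom CohFrm X Y"
  then have f: "f \<in> carrier X \<rightarrow> carrier Y" "f \<in> extensional (carrier X)"
    by (simp_all add: CohFrm_def coherent_frame_hom_def)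
  show "ccomp CohFrm X X Y f (cid CohFrm X) = f"
    using f by (auto simp: CohFrm_def compose_def fun_eq_iff extensional_def)
  show "ccomp CohFrm X Y Y (cid CohFrm Y) f = f"
    using f by (auto simp: CohFrm_def compose_def fun_eq_iff extensional_def)
next
  fix W X Y Z :: "'a gorder" and f g h :: "'a \<Rightarrow> 'a"
  assume "f \<in> chom CohFrm W X"
  then have "f \<in> carrier W \<rightarrow> carrier X"
    by (simp add: CohFrm_def coherent_frame_hom_def)
  then show "ccomp CohFrm W X Z (ccomp CohFrm X Y Z h g) f
      = ccomp CohFrm W Y Z h (ccomp CohFrm W X Y g f)"
    by (auto simp: CohFrm_def compose_def fun_eq_iff)
qed

section \<open>Functoriality of the induced maps\<close>

lemma (in ft_g_semiring) Id_g_map_id: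
  "Id_g_map S S (\<lambda>x\<in>carrier S. x) = (\<lambda>I\<in>carrier (Id_g S). I)"
proof -
  interpret g_hom_pair S S "\<lambda>x\<in>carrier S. x"
    by unfold_locales (rule g_hom_id)
  have "Id_g_map S S (\<lambda>x\<in>carrier S. x) I = I" if "g_closed S I" for I
  proof -
    have "(\<lambda>x\<in>carrier S. x) ` I = I"
      using g_closed_subset_carrier[OF that] by force
    then show ?thesis
      using that by (simp add: Id_g_map_eq sup_g_prin_self)
  qed
  then show ?thesis
    by (intro extensionalityI[of _ "carrier (Id_g S)"]) (simp_all add: Id_g_map_def carrier_Id_g)
qed

text \<open>The value of the first map at \<open>I\<close> is already a join of closures
  \<open>g_prin T (f a)\<close>, which the second map sends termwise to
  \<open>g_prin U (g (f a))\<close>.\<close>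

lemma Id_g_map_compose:
  assumes "ft_g_semiring S" "ft_g_semiring T" "ft_g_semiring U"
    and f: "f \<in> g_hom S T" and g: "g \<in> g_hom T U"
  shows "Id_g_map S U (compose (carrier S) g f) =
    compose (carrier (Id_g S)) (Id_g_map T U g) (Id_g_map S T f)"
proof -
  interpret S: ft_g_semiring S by fact
  interpret T: ft_g_semiring T by fact
  interpret U: ft_g_semiring U by fact
  interpret f: g_hom_pair S T f by unfold_locales (rule f)
  interpret g: g_hom_pair T U g by unfold_locales (rule g)
  interpret gf: g_hom_pair S U "compose (carrier S) g f"
    by unfold_locales (rule g_hom_compose[OF S.comm_semiring_axioms f g])
  have "Id_g_map S U (compose (carrier S) g f) I = Id_g_map T U g (Id_g_map S T f I)"
    if I: "g_closed S I" for I
  proof -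
    have "compose (carrier S) g f ` I = g ` f ` I"
      unfolding image_image using S.g_closed_subset_carrier[OF I]
      by (intro image_cong) (auto simp: compose_def)
    moreover have "f ` I \<subseteq> carrier T"
      using S.g_closed_subset_carrier[OF I] f.hom_closed by auto
    ultimately show ?thesis
      using I by (simp only: f.Id_g_map_eq gf.Id_g_map_eq g.Id_g_map_sup_g_prin)
  qed
  then show ?thesis
    by (intro extensionalityI[of _ "carrier (Id_g S)"])
       (simp_all add: Id_g_map_def[of S U] compose_def carrier_Id_g)
qed

theorem proposition10p3:
  shows "(\<forall>(S :: 'a ring) (T :: 'b ring) \<phi>.
            ft_g_semiring S \<and> ft_g_semiring T \<and> \<phi> \<in> g_hom S T \<longrightarrow>
              coherent_frame (Id_g S) \<and> coherent_frame (Id_g T) \<and>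
              Id_g_map S T \<phi> \<in> coherent_frame_hom (Id_g S) (Id_g T))
       \<and> is_functor (CRig_g :: ('u ring, 'u \<Rightarrow> 'u) category) CohFrm Id_g Id_g_map"
proof (intro conjI allI impI)
  fix S :: "'a ring" and T :: "'b ring" and \<phi> :: "'a \<Rightarrow> 'b"
  assume *: "ft_g_semiring S \<and> ft_g_semiring T \<and> \<phi> \<in> g_hom S T"
  then show "coherent_frame (Id_g S)" "coherent_frame (Id_g T)"
    by (simp_all add: ft_g_semiring.coherent_frame_Id_g)
  show "Id_g_map S T \<phi> \<in> coherent_frame_hom (Id_g S) (Id_g T)"
    using * by (simp add: g_hom_pair.Id_g_map_coherent g_hom_pair_def g_hom_pair_axioms_def)
next
  interpret C: is_category "CRig_g :: ('u ring, 'u \<Rightarrow> 'u) category"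
    by (rule is_category_CRig_g)
  interpret D: is_category "CohFrm :: ('u set gorder, 'u set \<Rightarrow> 'u set) category"
    by (rule is_category_CohFrm)
  show "is_functor (CRig_g :: ('u ring, 'u \<Rightarrow> 'u) category) CohFrm Id_g Id_g_map"
  proof
    fix X :: "'u ring" assume "X \<in> cobj CRig_g"
    then interpret ft_g_semiring X by (simp add: CRig_g_def)
    show "Id_g X \<in> cobj CohFrm"
      using coherent_frame_Id_g by (simp add: CohFrm_def)
    show "Id_g_map X X (cid CRig_g X) = cid CohFrm (Id_g X)"
      using Id_g_map_id by (simp add: CRig_g_def CohFrm_def)
  next
    fix X Y :: "'u ring" and f :: "'u \<Rightarrow> 'u"
    assume "X \<in> cobj CRig_g" "Y \<in> cobj CRig_g" "f \<in> chom CRig_g X Y"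
    then have "Id_g_map X Y f \<in> coherent_frame_hom (Id_g X) (Id_g Y)"
      by (simp add: CRig_g_def g_hom_pair.Id_g_map_coherent g_hom_pair_def g_hom_pair_axioms_def)
    \<comment> \<open>Extensionality of the morphism is built into the restricted abstraction in
      \<open>Id_g_map\<close>.\<close>
    then show "Id_g_map X Y f \<in> chom CohFrm (Id_g X) (Id_g Y)"
      by (simp add: CohFrm_def Id_g_map_def)
  next
    fix X Y Z :: "'u ring" and f g :: "'u \<Rightarrow> 'u"
    assume "X \<in> cobj CRig_g" "Y \<in> cobj CRig_g" "Z \<in> cobj CRig_g"
      "f \<in> chom CRig_g X Y" "g \<in> chom CRig_g Y Z"
    then show "Id_g_map X Z (ccomp CRig_g X Y Z g f) =
        ccomp CohFrm (Id_g X) (Id_g Y) (Id_g Z) (Id_g_map Y Z g) (Id_g_map X Y f)"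
      by (simp add: CRig_g_def CohFrm_def Id_g_map_compose)
  qed
qed

end
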